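(* Let $X$ be a metric space. Let $F_i:X\to2^{\mathbb{R}^{m_i}}$, $i=1,2$, be set-valued mappings, continuous in the Hausdorff metric, each of whose images is either a strictly convex compact set or a single point. Let $\mathcal{L}_i=\mathbb{R}^{m_i}$, $i=1,2$, and let $L:\mathcal{L}_1\oplus\mathcal{L}_2\to\mathbb{R}^k$ be a linear surjection such that $\mathcal{L}=\ker L$ is not parallel to $\mathcal{L}_i$, $i=1,2$. Then for any continuous selection $f(x)\in L(F_1(x),F_2(x))$, $x\in X$, there exist continuous selections $f_i(x)\in F_i(x)$, $i=1,2$, such that $f(x)=L(f_1(x),f_2(x))$ for all $x\in X$.
   Context: Images are nonempty. A subspace $\mathcal{L}\subset\mathcal{L}_1\oplus\mathcal{L}_2$ is said to be not parallel to the subspaces $\mathcal{L}_1$ and $\mathcal{L}_2$ if for any pair of distinct points $w_1,w_2\in\mathcal{L}$ the projections of $w_1$ and $w_2$ onto $\mathcal{L}_1$ parallel to $\mathcal{L}_2$ are different, and the projections of $w_1$ and $w_2$ onto $\mathcal{L}_2$ parallel to $\mathcal{L}_1$ are different. A convex set in $\mathbb{R}^m$ is strictly convex if the midpoint of any two of its distinct points lies in its interior (in $\mathbb{R}^m$). $L(F_1(x),F_2(x))=\{L(y_1,y_2):y_1\in F_1(x),\ y_2\in F_2(x)\}$. A continuous selection of a set-valued mapping is a continuous single-valued function whose value at each point belongs to the image set at that point. The Hausdorff distance is $h(A,B)=\inf\{h>0 : A\subset B+B_h(0),\ B\subset A+B_h(0)\}$, where $B_h(0)$ is the closed ball of radius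 $h$ centered at $0$. *)

theory Defs
  imports "HOL-Analysis.Analysis"
begin

definition strictly_convex :: "'a::euclidean_space set \<Rightarrow> bool" where
  "strictly_convex S \<longleftrightarrow>
     convex S \<and> (\<forall>x\<in>S. \<forall>y\<in>S. x \<noteq> y \<longrightarrow> midpoint x y \<in> interior S)"

text \<open>Here \<open>+\<close> on sets is the Minkowski sum. The infimum is a real one, so the value is
  meaningful only for nonempty bounded sets; otherwise the set of radii may be empty.\<close>

definition hausdorff_distance :: "'a::real_normed_vector set \<Rightarrow> 'a set \<Rightarrow> real" where
  "hausdorff_distance A B =
     Inf {h. h > 0 \<and> A \<subseteq> B + cball 0 h \<and> B \<subseteq> A + cball 0 h}"

definition hausdorff_continuous_on ::
    "'x::metric_space set \<Rightarrow> ('x \<Rightarrow> 'a::real_normed_vector set) \<Rightarrow> bool" where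
  "hausdorff_continuous_on X F \<longleftrightarrow>
     (\<forall>x\<in>X. \<forall>e>0. \<exists>d>0. \<forall>y\<in>X. dist y x < d \<longrightarrow> hausdorff_distance (F y) (F x) < e)"

definition continuous_selection ::
    "'x::topological_space set \<Rightarrow> ('x \<Rightarrow> 'a::topological_space set) \<Rightarrow> ('x \<Rightarrow> 'a) \<Rightarrow> bool" where
  "continuous_selection X F f \<longleftrightarrow> continuous_on X f \<and> (\<forall>x\<in>X. f x \<in> F x)"

text \<open>The direct sum of the two spaces is the product type; the projection onto either summand
  parallel to the other one is then \<^const>\<open>fst\<close>, respectively \<^const>\<open>snd\<close>.\<close>

definition not_parallel :: "('a \<times> 'b) set \<Rightarrow> bool" where
  "not_parallel S \<longleftrightarrow>
     (\<forall>w1\<in>S. \<forall>w2\<in>S. w1 \<noteq> w2 \<longrightarrow> fst w1 \<noteq> fst w2 \<and> snd w1 \<noteq> snd w2)"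

end

theory Submission
  imports Defs
begin

text \<open>
  Let \<open>P x = F1 x \<times> F2 x\<close> and let \<open>G x\<close> be the set of all \<open>w \<in> P x\<close> with \<open>L w = f x\<close>. Pairs of
  selections with \<open>f x = L (f1 x, f2 x)\<close> are the same as selections of \<open>G\<close>. The values of \<open>G\<close>
  are nonempty, compact and convex, so the point of least norm in \<open>G x\<close> is a canonical choice,
  and it depends continuously on \<open>x\<close> as soon as \<open>G\<close> does.

  Upper semicontinuity of \<open>G\<close> follows from the continuity of \<open>P\<close>, \<open>L\<close> and \<open>f\<close> by compactness, and
  where \<open>G x\<close> is a single point it already suffices. Lower semicontinuity is the real issue: the
  fibre \<open>{w. L w = f x}\<close> may touch \<open>P x\<close> only along its boundary, and then most of \<open>G x\<close> can be
  lost under a small perturbation. Strict convexity and the position of the kernel exclude this.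
  If \<open>G x\<close> contains two distinct points, their difference lies in \<open>ker L\<close>, so both of their
  components differ; hence neither \<open>F1 x\<close> nor \<open>F2 x\<close> is a single point, and the components of the
  midpoint are interior to \<open>F1 x\<close> and \<open>F2 x\<close>, so that the midpoint is interior to \<open>P x\<close>. The product
  itself is in general not strictly convex, so it matters that both components differ.

  A fibre through an interior point of \<open>P x\<close> is stable: every point of \<open>G x\<close> can be moved slightly
  inside \<open>G x\<close> to the centre of a ball contained in \<open>P x\<close>, a smaller concentric ball remains in
  \<open>P y\<close> for \<open>y\<close> near \<open>x\<close> (\<open>ball_subset_close_convex\<close>), and a linear right inverse of
  \<open>L\<close> shifts the centre onto the fibre over \<open>f y\<close> without leaving that ball
  (\<open>lower_semicontinuous_section\<close>).
\<close>

section \<open>Hausdorff continuity in terms of points\<close>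

definition hausdorff_close :: "real \<Rightarrow> 'a::metric_space set \<Rightarrow> 'a set \<Rightarrow> bool" where
  "hausdorff_close e A B \<longleftrightarrow> (\<forall>a\<in>A. \<exists>b\<in>B. dist a b < e) \<and> (\<forall>b\<in>B. \<exists>a\<in>A. dist a b < e)"

text \<open>Phrased with points instead of an infimum of radii, continuity passes directly to products and
  is easily combined with limits.\<close>

definition set_continuous_on :: "'x::metric_space set \<Rightarrow> ('x \<Rightarrow> 'a::metric_space set) \<Rightarrow> bool" where
  "set_continuous_on X P \<longleftrightarrow>
     (\<forall>x\<in>X. \<forall>e>0. \<exists>d>0. \<forall>y\<in>X. dist y x < d \<longrightarrow> hausdorff_close e (P y) (P x))"

text \<open>Boundedness makes the set of admissible radii nonempty; otherwise its real infimum is an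
  arbitrary number and says nothing about the two sets.\<close>

lemma hausdorff_distance_less_imp_close:
  fixes A B :: "'a::real_normed_vector set"
  assumes "A \<noteq> {}" "B \<noteq> {}" "bounded A" "bounded B" and less: "hausdorff_distance A B < e"
  shows "hausdorff_close e A B"
proof -
  let ?R = "{h. h > 0 \<and> A \<subseteq> B + cball 0 h \<and> B \<subseteq> A + cball 0 h}"
  obtain K1 where K1: "\<And>a. a \<in> A \<Longrightarrow> norm a \<le> K1"
    using \<open>bounded A\<close> by (auto simp: bounded_iff)
  obtain K2 where K2: "\<And>b. b \<in> B \<Longrightarrow> norm b \<le> K2"
    using \<open>bounded B\<close> by (auto simp: bounded_iff)
  obtain a0 b0 where "a0 \<in> A" "b0 \<in> B"
    using assms by blast
  have diff: "norm (a - b) \<le> \<bar>K1\<bar> + \<bar>K2\<bar> + 1" if "a \<in> A" "b \<in> B" for a b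
    using K1[OF that(1)] K2[OF that(2)] norm_triangle_ineq4[of a b] by linarith
  have cover: "S \<subseteq> T + cball 0 h" if "t0 \<in> T" "\<And>s. s \<in> S \<Longrightarrow> norm (s - t0) \<le> h"
    for S T :: "'a set" and t0 h
  proof
    fix s assume "s \<in> S"
    then have "t0 + (s - t0) \<in> T + cball 0 h"
      using that by (intro set_plus_intro) auto
    then show "s \<in> T + cball 0 h" by simp
  qed
  have "A \<subseteq> B + cball 0 (\<bar>K1\<bar> + \<bar>K2\<bar> + 1)"
    using diff \<open>b0 \<in> B\<close> by (intro cover[of b0]) auto
  moreover have "B \<subseteq> A + cball 0 (\<bar>K1\<bar> + \<bar>K2\<bar> + 1)"
    using diff[OF \<open>a0 \<in> A\<close>] \<open>a0 \<in> A\<close>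
    by (intro cover[of a0]) (simp_all add: norm_minus_commute)
  ultimately have "\<bar>K1\<bar> + \<bar>K2\<bar> + 1 \<in> ?R" by auto
  then have "?R \<noteq> {}" by blast
  then obtain h where h: "h < e" "A \<subseteq> B + cball 0 h" "B \<subseteq> A + cball 0 h"
    using cInf_lessD[OF _ less[unfolded hausdorff_distance_def]] by blast
  have point: "\<exists>t\<in>T. dist s t < e" if sub: "S \<subseteq> T + cball 0 h" and s: "s \<in> S" for S T :: "'a set" and s
  proof -
    obtain t c where "t \<in> T" "c \<in> cball 0 h" "s = t + c"
      using subsetD[OF sub s] by (rule set_plus_elim)
    then show ?thesis
      using h(1) by (intro bexI[of _ t]) (auto simp: dist_norm)
  qed
  show ?thesis
    unfolding hausdorff_close_def
    using point[OF h(2)] point[OF h(3)] by (simp add: dist_commute)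
qed

lemma set_continuous_on_if_hausdorff_continuous_on:
  assumes "hausdorff_continuous_on X F"
    and "\<And>x. x \<in> X \<Longrightarrow> F x \<noteq> {}" and "\<And>x. x \<in> X \<Longrightarrow> bounded (F x)"
  shows "set_continuous_on X F"
  unfolding set_continuous_on_def
proof (intro ballI allI impI)
  fix x and e :: real assume x: "x \<in> X" and "e > 0"
  then obtain d where "d > 0" "\<forall>y\<in>X. dist y x < d \<longrightarrow> hausdorff_distance (F y) (F x) < e"
    using assms(1) unfolding hausdorff_continuous_on_def by blast
  then show "\<exists>d>0. \<forall>y\<in>X. dist y x < d \<longrightarrow> hausdorff_close e (F y) (F x)"
    using assms(2,3) x by (intro exI[of _ d]) (simp add: hausdorff_distance_less_imp_close)
qed

lemma hausdorff_close_Times: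
  assumes "hausdorff_close e A B" "hausdorff_close e C D"
  shows "hausdorff_close (2 * e) (A \<times> C) (B \<times> D)"
proof -
  have pair: "dist (a, c) (b, d) < 2 * e" if "dist a b < e" "dist c d < e"
    for a b :: 'a and c d :: 'b
    using that sqrt_sum_squares_le_sum[of "dist a b" "dist c d"] by (simp add: dist_Pair_Pair)
  show ?thesis
    unfolding hausdorff_close_def
  proof (intro conjI ballI)
    fix p assume "p \<in> A \<times> C"
    then obtain b d where "b \<in> B" "dist (fst p) b < e" "d \<in> D" "dist (snd p) d < e"
      using assms unfolding hausdorff_close_def by fastforce
    then show "\<exists>q\<in>B \<times> D. dist p q < 2 * e"
      using pair[of "fst p" b "snd p" d] by (intro bexI[of _ "(b, d)"]) auto
  next
    fix q assume "q \<in> B \<times> D"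
    then obtain a c where "a \<in> A" "dist a (fst q) < e" "c \<in> C" "dist c (snd q) < e"
      using assms unfolding hausdorff_close_def by fastforce
    then show "\<exists>p\<in>A \<times> C. dist p q < 2 * e"
      using pair[of a "fst q" c "snd q"] by (intro bexI[of _ "(a, c)"]) auto
  qed
qed

lemma set_continuous_on_Times:
  assumes F: "set_continuous_on X F" and G: "set_continuous_on X G"
  shows "set_continuous_on X (\<lambda>x. F x \<times> G x)"
  unfolding set_continuous_on_def
proof (intro ballI allI impI)
  fix x and e :: real assume x: "x \<in> X" and "e > 0"
  then have e2: "e/2 > 0" by simp
  obtain d1 where d1: "d1 > 0" "\<forall>y\<in>X. dist y x < d1 \<longrightarrow> hausdorff_close (e/2) (F y) (F x)"
    using F x e2 unfolding set_continuous_on_def by blast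
  obtain d2 where d2: "d2 > 0" "\<forall>y\<in>X. dist y x < d2 \<longrightarrow> hausdorff_close (e/2) (G y) (G x)"
    using G x e2 unfolding set_continuous_on_def by blast
  show "\<exists>d>0. \<forall>y\<in>X. dist y x < d \<longrightarrow> hausdorff_close e (F y \<times> G y) (F x \<times> G x)"
        using d1 d2 hausdorff_close_Times[where e = "e/2"]
    by (intro exI[of _ "min d1 d2"] conjI ballI impI) fastforce+
qed

text \<open>This is upper semicontinuity in the form in which it passes to closed conditions such as
  \<open>L w = f x\<close>. The points \<open>v n\<close> are asymptotically equal to their nearest points in the fixed compact
  set \<open>P x\<close>, and the latter have a convergent subsequence.\<close>

lemma set_continuous_on_subsequential_limit:
  fixes P :: "'x::metric_space \<Rightarrow> 'a::euclidean_space set"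
  assumes P: "set_continuous_on X P" and x: "x \<in> X" and "compact (P x)"
    and xs: "\<And>n. xs n \<in> X" "xs \<longlonglongrightarrow> x" and v: "\<And>n. v n \<in> P (xs n)"
  obtains l r where "l \<in> P x" "strict_mono (r :: nat \<Rightarrow> nat)" "(v \<circ> r) \<longlonglongrightarrow> l"
proof -
  have near: "\<forall>\<^sub>F n in sequentially. \<exists>u\<in>P x. dist (v n) u < e" if "e > 0" for e
  proof -
    obtain d where "d > 0" and d: "\<forall>y\<in>X. dist y x < d \<longrightarrow> hausdorff_close e (P y) (P x)"
      using P x \<open>e > 0\<close> unfolding set_continuous_on_def by blast
    have "\<forall>\<^sub>F n in sequentially. dist (xs n) x < d"
      using xs(2) \<open>d > 0\<close> by (rule tendstoD)
    then show ?thesis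
      by eventually_elim (use d xs v in \<open>auto simp: hausdorff_close_def\<close>)
  qed
  have "P x \<noteq> {}"
    using near[of 1] by (auto simp: eventually_sequentially)
  define u where "u n = closest_point (P x) (v n)" for n
  have u: "u n \<in> P x" "\<forall>w\<in>P x. dist (v n) (u n) \<le> dist (v n) w" for n
    unfolding u_def using closest_point_exists \<open>compact (P x)\<close> \<open>P x \<noteq> {}\<close>
    by (blast intro: compact_imp_closed)+
  have "(\<lambda>n. dist (v n) (u n)) \<longlonglongrightarrow> 0"
  proof (rule tendstoI)
    fix e :: real assume "e > 0"
    from near[OF this] show "\<forall>\<^sub>F n in sequentially. dist (dist (v n) (u n)) 0 < e"
    proof eventually_elim
      case (elim n)
      then obtain w where "w \<in> P x" "dist (v n) w < e" by blast
      then show ?case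
        using u(2)[of n] by (metis abs_of_nonneg diff_zero dist_real_def le_less_trans zero_le_dist)
    qed
  qed
  then have diff: "(\<lambda>n. v n - u n) \<longlonglongrightarrow> 0"
    by (simp add: dist_norm tendsto_norm_zero_iff)
  obtain l r where lr: "l \<in> P x" "strict_mono (r :: nat \<Rightarrow> nat)" "(u \<circ> r) \<longlonglongrightarrow> l"
    using \<open>compact (P x)\<close> u(1) unfolding compact_def by blast
  have "(\<lambda>n. (v (r n) - u (r n)) + u (r n)) \<longlonglongrightarrow> 0 + l"
    using LIMSEQ_subseq_LIMSEQ[OF diff lr(2)] lr(3) by (intro tendsto_add) (simp_all add: o_def)
  then show ?thesis
    using lr that by (simp add: o_def)
qed

section \<open>Continuity of the point of least norm\<close>

text \<open>By \<open>upper\<close>, least norm points at \<open>xs n \<longlonglongrightarrow> x\<close> accumulate at some \<open>l \<in> G x\<close>. By \<open>lower\<close>, the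
  least norm point of \<open>G x\<close> is approximated by points of \<open>G (xs n)\<close>, so \<open>l\<close> cannot have larger
  norm, and the least norm point of a closed convex set is unique. When \<open>G x\<close> is a singleton,
  \<open>l \<in> G x\<close> alone identifies \<open>l\<close>.\<close>

lemma continuous_on_least_norm_point:
  fixes G :: "'x::metric_space \<Rightarrow> 'a::euclidean_space set"
  assumes G: "\<And>x. x \<in> X \<Longrightarrow> closed (G x) \<and> convex (G x) \<and> G x \<noteq> {}"
    and upper: "\<And>x xs v. x \<in> X \<Longrightarrow> (\<And>n. xs n \<in> X) \<Longrightarrow> xs \<longlonglongrightarrow> x \<Longrightarrow> (\<And>n. v n \<in> G (xs n))
        \<Longrightarrow> \<exists>l\<in>G x. \<exists>r :: nat \<Rightarrow> nat. strict_mono r \<and> (v \<circ> r) \<longlonglongrightarrow> l"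
    and lower: "\<And>x w e. x \<in> X \<Longrightarrow> w \<in> G x \<Longrightarrow> \<not> is_singleton (G x) \<Longrightarrow> e > 0
        \<Longrightarrow> \<exists>d>0. \<forall>y\<in>X. dist y x < d \<longrightarrow> (\<exists>v\<in>G y. dist v w < e)"
  shows "continuous_on X (\<lambda>x. closest_point (G x) 0)"
proof (rule ccontr)
  let ?s = "\<lambda>x. closest_point (G x) 0"
  have s: "?s x \<in> G x" "\<And>v. v \<in> G x \<Longrightarrow> norm (?s x) \<le> norm v" if "x \<in> X" for x
    using closest_point_exists[of "G x" 0] G[OF that] by auto
  assume "\<not> continuous_on X ?s"
  then obtain x e where x: "x \<in> X" and "e > 0"
    and bad: "\<And>d. d > 0 \<Longrightarrow> \<exists>y\<in>X. dist y x < d \<and> \<not> dist (?s y) (?s x) < e"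
    unfolding continuous_on_iff by blast
  have "\<exists>xs. \<forall>n. xs n \<in> X \<and> dist (xs n) x < inverse (real (Suc n)) \<and> \<not> dist (?s (xs n)) (?s x) < e"
    using bad by (intro choice allI) (simp add: Bex_def)
  then obtain xs where xs: "\<And>n. xs n \<in> X" "\<And>n. dist (xs n) x < inverse (real (Suc n))"
    "\<And>n. dist (?s (xs n)) (?s x) \<ge> e"
    by (metis not_less)
  have "(\<lambda>n. dist (xs n) x) \<longlonglongrightarrow> 0"
    by (rule tendsto_sandwich[OF _ _ tendsto_const LIMSEQ_inverse_real_of_nat])
       (use xs(2) in \<open>auto intro: always_eventually less_imp_le\<close>)
  then have lim: "xs \<longlonglongrightarrow> x"
    by (rule tendsto_dist_iff[THEN iffD2])
  obtain l r where l: "l \<in> G x" and r: "strict_mono (r :: nat \<Rightarrow> nat)"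
    and sl: "((\<lambda>n. ?s (xs n)) \<circ> r) \<longlonglongrightarrow> l"
    using upper[OF x xs(1) lim, of "\<lambda>n. ?s (xs n)"] s(1)[OF xs(1)] by blast
  have "norm l \<le> norm (?s x)"
  proof (cases "is_singleton (G x)")
    case True
    then show ?thesis
      using l s(1)[OF x] by (auto simp: is_singleton_def)
  next
    case False
    have bound: "norm l \<le> norm (?s x) + c" if "c > 0" for c
    proof -
      obtain d where "d > 0" and d: "\<And>y. y \<in> X \<Longrightarrow> dist y x < d \<Longrightarrow> \<exists>v\<in>G y. dist v (?s x) < c"
        using lower[OF x s(1)[OF x] False \<open>c > 0\<close>] by blast
      have "\<forall>\<^sub>F n in sequentially. dist ((xs \<circ> r) n) x < d"
        using LIMSEQ_subseq_LIMSEQ[OF lim r] \<open>d > 0\<close> by (rule tendstoD)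
      then have "\<forall>\<^sub>F n in sequentially. norm (((\<lambda>n. ?s (xs n)) \<circ> r) n) \<le> norm (?s x) + c"
      proof eventually_elim
        case (elim n)
        then obtain v where v: "v \<in> G (xs (r n))" "dist v (?s x) < c"
          using d[OF xs(1)] by auto
        have "norm v \<le> norm (?s x) + norm (v - ?s x)"
          using norm_triangle_sub[of v "?s x"] by simp
        then show ?case
          using s(2)[OF xs(1) v(1)] v(2) by (simp add: dist_norm)
      qed
      then show ?thesis
        using tendsto_upperbound[OF tendsto_norm[OF sl]] by simp
    qed
    then show ?thesis
      by (rule field_le_epsilon)
  qed
  then have "\<forall>z\<in>G x. dist 0 l \<le> dist 0 z"
    using order_trans[OF _ s(2)[OF x]] by simp
  then have "l = ?s x"
    using closest_point_unique[of "G x" l 0] G[OF x] l by blast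
  then have "\<forall>\<^sub>F n in sequentially. dist (((\<lambda>n. ?s (xs n)) \<circ> r) n) (?s x) < e"
    using tendstoD[OF sl \<open>e > 0\<close>] by simp
  then show False
    using xs(3) by (auto simp: eventually_sequentially dest!: leD)
qed

section \<open>Sections of a continuous family of convex sets\<close>

text \<open>If a point \<open>v\<close> of the smaller ball were outside \<open>A\<close>, a hyperplane would separate it from \<open>A\<close>.
  Moving \<open>v\<close> by the distance \<open>s\<close> away from \<open>A\<close>, orthogonally to the hyperplane, stays within the
  larger ball but gives a point of \<open>B\<close> at distance at least \<open>s\<close> from \<open>A\<close>.\<close>

lemma ball_subset_close_convex:
  fixes A B :: "'a::euclidean_space set"
  assumes "closed A" "convex A" and close: "\<And>b. b \<in> B \<Longrightarrow> \<exists>a\<in>A. dist a b < s"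
    and "s > 0" and sub: "ball z (r + s) \<subseteq> B"
  shows "ball z r \<subseteq> A"
proof
  fix v assume v: "v \<in> ball z r"
  show "v \<in> A"
  proof (rule ccontr)
    assume "v \<notin> A"
    then obtain a b where ab: "a \<bullet> v < b" "\<And>u. u \<in> A \<Longrightarrow> b < a \<bullet> u"
      using separating_hyperplane_closed_point[OF assms(2,1)] by blast
    define p where "p = v - s *\<^sub>R sgn a"
    have "dist v p \<le> s"
      using \<open>s > 0\<close> by (simp add: p_def dist_norm norm_sgn)
    then have "dist z p < r + s"
      using v dist_triangle[of z p v] by simp
    then obtain u where u: "u \<in> A" "dist u p < s"
      using close sub by (meson mem_ball subsetD)
    have "a \<bullet> (u - p) \<le> norm a * norm (u - p)"
      by (rule norm_cauchy_schwarz)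
    also have "\<dots> \<le> norm a * s"
      using u(2) by (intro mult_left_mono) (auto simp: dist_norm)
    finally have "a \<bullet> u \<le> a \<bullet> p + norm a * s"
      by (simp add: inner_diff_right)
    also have "a \<bullet> p = a \<bullet> v - s * norm a"
      by (cases "a = 0")
         (simp_all add: p_def inner_diff_right sgn_div_norm dot_square_norm power2_eq_square)
    finally show False
      using ab(1) ab(2)[OF u(1)] by simp
  qed
qed

text \<open>An interior point \<open>p\<close> on the fibre makes the open segment from \<open>w\<close> to \<open>p\<close> interior as well, so
  \<open>w\<close> is a limit of interior points \<open>z\<close> of the same fibre. Each such \<open>z\<close> survives a perturbation of
  both the convex set and the fibre.\<close>

lemma lower_semicontinuous_section:
  fixes P :: "'x::metric_space \<Rightarrow> 'a::euclidean_space set" and L :: "'a \<Rightarrow> 'b::euclidean_space"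
  assumes P: "set_continuous_on X P" and cl: "\<And>x. x \<in> X \<Longrightarrow> closed (P x) \<and> convex (P x)"
    and L: "linear L" "surj L" and f: "continuous_on X f" and x: "x \<in> X"
    and w: "w \<in> P x" "L w = f x" and p: "p \<in> interior (P x)" "L p = f x" and "e > 0"
  shows "\<exists>d>0. \<forall>y\<in>X. dist y x < d \<longrightarrow> (\<exists>v\<in>P y. L v = f y \<and> dist v w < e)"
proof -
  obtain g where g: "linear g" "\<And>u. L (g u) = u"
    using linear_surj_right_inverse[OF L(1), of UNIV UNIV] L(2) by auto
  \<comment> \<open>The step from \<open>w\<close> towards \<open>p\<close> has length less than \<open>e\<close>; adding 1 to the norm covers \<open>p = w\<close>.\<close>
  define t where "t = min 1 (e / (norm (p - w) + 1))"
  have den: "norm (p - w) + 1 > 0" by (simp add: add_nonneg_pos)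
  have t: "0 < t" "t \<le> 1"
    using \<open>e > 0\<close> den by (simp_all add: t_def)
  have "t \<le> e / (norm (p - w) + 1)"
    by (simp add: t_def)
  then have "t * (norm (p - w) + 1) \<le> e"
    using den by (simp only: pos_le_divide_eq)
  then have te: "t * norm (p - w) < e"
    using t(1) by (simp add: distrib_left)
  define z where "z = w - t *\<^sub>R (w - p)"
  have "z \<in> interior (P x)"
    using cl[OF x] p(1) w(1) t(1,2) unfolding z_def by (simp add: mem_interior_convex_shrink)
  then obtain r where r: "r > 0" "ball z r \<subseteq> P x"
    unfolding mem_interior by blast
  have Lz: "L z = f x"
    using w(2) p(2) by (simp add: z_def linear_diff[OF L(1)] linear_scale[OF L(1)])
  have zw: "dist z w < e"
    using t(1) te by (simp add: z_def dist_norm norm_minus_commute)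
  \<comment> \<open>A correction of size less than \<open>c\<close> keeps \<open>z\<close> in the half-radius ball and within \<open>e\<close> of \<open>w\<close>.\<close>
  define c where "c = min (r/2) (e - dist z w)"
  have "c > 0"
    using r zw by (simp add: c_def)
  have "continuous_on X (\<lambda>y. g (f y))"
    using bounded_linear.continuous_on[OF _ f] g(1) by (simp add: linear_conv_bounded_linear)
  then obtain d1 where d1: "d1 > 0" "\<And>y. y \<in> X \<Longrightarrow> dist y x < d1 \<Longrightarrow> dist (g (f y)) (g (f x)) < c"
    using x \<open>c > 0\<close> unfolding continuous_on_iff by blast
  obtain d2 where d2: "d2 > 0" "\<And>y. y \<in> X \<Longrightarrow> dist y x < d2 \<Longrightarrow> hausdorff_close (r/2) (P y) (P x)"
    using P x half_gt_zero[OF r(1)] unfolding set_continuous_on_def by blast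
  show ?thesis
  proof (intro exI[of _ "min d1 d2"] conjI ballI impI)
    show "min d1 d2 > 0" using d1 d2 by simp
    fix y assume y: "y \<in> X" "dist y x < min d1 d2"
    define v where "v = z + (g (f y) - g (f x))"
    have vz: "dist v z < c"
      using d1(2)[of y] y by (simp add: v_def dist_norm)
    have close: "\<exists>a\<in>P y. dist a b < r/2" if "b \<in> P x" for b
      using d2(2)[of y] y that unfolding hausdorff_close_def by simp
    have "ball z (r/2) \<subseteq> P y"
      by (rule ball_subset_close_convex[OF _ _ close]) (use cl[OF y(1)] r in simp_all)
    moreover have "v \<in> ball z (r/2)"
      using vz by (simp add: c_def dist_commute)
    ultimately have "v \<in> P y" by (rule subsetD)
    moreover have "L v = f y"
      by (simp add: v_def linear_add[OF L(1)] linear_diff[OF L(1)] g(2) Lz)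
    moreover have "dist v w < e"
      using vz dist_triangle[of v w z] by (simp add: c_def)
    ultimately show "\<exists>v\<in>P y. L v = f y \<and> dist v w < e" by blast
  qed
qed

text \<open>The hypothesis \<open>int\<close> says that a fibre which meets \<open>P x\<close> in more than one point meets its
  interior. This is the only form in which strict convexity enters; it gives lower semicontinuity
  of the sections wherever they are not singletons.\<close>

theorem continuous_selection_of_section:
  fixes P :: "'x::metric_space \<Rightarrow> 'a::euclidean_space set" and L :: "'a \<Rightarrow> 'b::euclidean_space"
  assumes P: "set_continuous_on X P" and cc: "\<And>x. x \<in> X \<Longrightarrow> compact (P x) \<and> convex (P x)"
    and L: "linear L" "surj L" and f: "continuous_on X f"
    and ne: "\<And>x. x \<in> X \<Longrightarrow> \<exists>w\<in>P x. L w = f x"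
    and int: "\<And>x w w'. x \<in> X \<Longrightarrow> w \<in> P x \<Longrightarrow> w' \<in> P x \<Longrightarrow> L w = f x \<Longrightarrow> L w' = f x \<Longrightarrow> w \<noteq> w'
        \<Longrightarrow> \<exists>p\<in>interior (P x). L p = f x"
  shows "\<exists>s. continuous_on X s \<and> (\<forall>x\<in>X. s x \<in> P x \<and> L (s x) = f x)"
proof -
  define G where "G x = P x \<inter> L -` {f x}" for x
  have contL: "continuous_on S L" for S
    using L(1) by (rule linear_continuous_on[OF linear_conv_bounded_linear[THEN iffD1]])
  have G: "closed (G x) \<and> convex (G x) \<and> G x \<noteq> {}" if "x \<in> X" for x
  proof (intro conjI)
    show "closed (G x)"
      unfolding G_def using cc[OF that] contL
      by (intro closed_Int compact_imp_closed closed_vimage) auto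
    show "convex (G x)"
      unfolding G_def using cc[OF that] L(1)
      by (intro convex_Int convex_linear_vimage) auto
    show "G x \<noteq> {}"
      using ne[OF that] by (auto simp: G_def)
  qed
  have "continuous_on X (\<lambda>x. closest_point (G x) 0)"
  proof (rule continuous_on_least_norm_point)
    show "closed (G x) \<and> convex (G x) \<and> G x \<noteq> {}" if "x \<in> X" for x
      by (rule G[OF that])
  next
    fix x xs v
    assume x: "x \<in> X" and xs: "\<And>n. xs n \<in> X" "xs \<longlonglongrightarrow> x" and v: "\<And>n. v n \<in> G (xs n)"
    obtain l r where lr: "l \<in> P x" "strict_mono (r :: nat \<Rightarrow> nat)" "(v \<circ> r) \<longlonglongrightarrow> l"
      using set_continuous_on_subsequential_limit[OF P x _ xs, of v] cc[OF x] v
      by (auto simp: G_def)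
    have "(\<lambda>n. L ((v \<circ> r) n)) \<longlonglongrightarrow> L l"
      using continuous_on_tendsto_compose[OF contL[of UNIV] lr(3)] by simp
    moreover have "(\<lambda>n. f ((xs \<circ> r) n)) \<longlonglongrightarrow> f x"
      using continuous_on_tendsto_compose[OF f LIMSEQ_subseq_LIMSEQ[OF xs(2) lr(2)] x] xs(1) by simp
    moreover have "(\<lambda>n. L ((v \<circ> r) n)) = (\<lambda>n. f ((xs \<circ> r) n))"
      using v by (auto simp: G_def)
    ultimately have "L l = f x"
      using LIMSEQ_unique by metis
    then show "\<exists>l\<in>G x. \<exists>r :: nat \<Rightarrow> nat. strict_mono r \<and> (v \<circ> r) \<longlonglongrightarrow> l"
      using lr by (auto simp: G_def)
  next
    fix x w and e :: real
    assume x: "x \<in> X" and w: "w \<in> G x" and "\<not> is_singleton (G x)" and "e > 0"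
    then obtain w' where "w' \<in> G x" "w \<noteq> w'"
      unfolding is_singleton_def by blast
    then obtain p where "p \<in> interior (P x)" "L p = f x"
      using int[OF x, of w w'] w by (auto simp: G_def)
    then show "\<exists>d>0. \<forall>y\<in>X. dist y x < d \<longrightarrow> (\<exists>v\<in>G y. dist v w < e)"
      using lower_semicontinuous_section[OF P _ L f x _ _ _ _ \<open>e > 0\<close>, of w p] w cc
      by (simp add: G_def compact_imp_closed Bex_def)
  qed
  moreover have "closest_point (G x) 0 \<in> G x" if "x \<in> X" for x
    using closest_point_exists(1)[of "G x" 0] G[OF that] by blast
  ultimately show ?thesis
    by (intro exI[of _ "\<lambda>x. closest_point (G x) 0"]) (auto simp: G_def)
qed

section \<open>Splitting a selection\<close>

theorem theorem2p10:
  fixes X :: "'x::metric_space set"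
    and F1 :: "'x \<Rightarrow> (real ^ 'm1) set"
    and F2 :: "'x \<Rightarrow> (real ^ 'm2) set"
    and L :: "(real ^ 'm1) \<times> (real ^ 'm2) \<Rightarrow> real ^ 'k"
    and f :: "'x \<Rightarrow> real ^ 'k"
  assumes "\<And>x. x \<in> X \<Longrightarrow> F1 x \<noteq> {}"
    and "\<And>x. x \<in> X \<Longrightarrow> F2 x \<noteq> {}"
    and "hausdorff_continuous_on X F1"
    and "hausdorff_continuous_on X F2"
    and "\<And>x. x \<in> X \<Longrightarrow> (strictly_convex (F1 x) \<and> compact (F1 x)) \<or> (\<exists>y. F1 x = {y})"
    and "\<And>x. x \<in> X \<Longrightarrow> (strictly_convex (F2 x) \<and> compact (F2 x)) \<or> (\<exists>y. F2 x = {y})"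
    and "linear L"
    and "surj L"
    and "not_parallel {w. L w = 0}"
    and "continuous_selection X (\<lambda>x. {L (y1, y2) | y1 y2. y1 \<in> F1 x \<and> y2 \<in> F2 x}) f"
  shows "\<exists>f1 f2. continuous_selection X F1 f1 \<and> continuous_selection X F2 f2 \<and>
           (\<forall>x\<in>X. f x = L (f1 x, f2 x))"
proof -
  have cc1: "compact (F1 x)" "convex (F1 x)" if "x \<in> X" for x
    using assms(5)[OF that] by (auto simp: strictly_convex_def)
  have cc2: "compact (F2 x)" "convex (F2 x)" if "x \<in> X" for x
    using assms(6)[OF that] by (auto simp: strictly_convex_def)
  have "set_continuous_on X F1"
    using set_continuous_on_if_hausdorff_continuous_on[OF assms(3,1)] cc1(1)
    by (simp add: compact_imp_bounded)
  moreover have "set_continuous_on X F2"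
    using set_continuous_on_if_hausdorff_continuous_on[OF assms(4,2)] cc2(1)
    by (simp add: compact_imp_bounded)
  ultimately have cont: "set_continuous_on X (\<lambda>x. F1 x \<times> F2 x)"
    by (rule set_continuous_on_Times)
  have f: "continuous_on X f" "\<And>x. x \<in> X \<Longrightarrow> \<exists>w\<in>F1 x \<times> F2 x. L w = f x"
    using assms(10) by (fastforce simp: continuous_selection_def)+
  have int: "\<exists>p\<in>interior (F1 x \<times> F2 x). L p = f x"
    if x: "x \<in> X" and w: "w \<in> F1 x \<times> F2 x" "w' \<in> F1 x \<times> F2 x" "L w = f x" "L w' = f x" "w \<noteq> w'"
    for x w w'
  proof (rule bexI)
    \<comment> \<open>The difference is compared with the origin, since \<open>w\<close> and \<open>w'\<close> need not lie in the kernel.\<close>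
    have ker: "w - w' \<in> {w. L w = 0}" "0 \<in> {w. L w = 0}"
      using w linear_diff[OF assms(7)] linear_0[OF assms(7)] by auto
    then have ne: "fst w \<noteq> fst w'" "snd w \<noteq> snd w'"
      using bspec[OF bspec[OF assms(9)[unfolded not_parallel_def] ker(1)] ker(2)] w(5) by simp_all
    have mem: "fst w \<in> F1 x" "fst w' \<in> F1 x" "snd w \<in> F2 x" "snd w' \<in> F2 x"
      using w by auto
    have "midpoint (fst w) (fst w') \<in> interior (F1 x)"
      using assms(5)[OF x] mem ne by (auto simp: strictly_convex_def)
    moreover have "midpoint (snd w) (snd w') \<in> interior (F2 x)"
      using assms(6)[OF x] mem ne by (auto simp: strictly_convex_def)
    ultimately show "midpoint w w' \<in> interior (F1 x \<times> F2 x)"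
      by (simp add: interior_Times midpoint_def mem_Times_iff)
    show "L (midpoint w w') = f x"
      using w by (simp add: midpoint_def linear_add[OF assms(7)] linear_scale[OF assms(7)] flip: scaleR_2)
  qed
  have cc: "compact (F1 x \<times> F2 x) \<and> convex (F1 x \<times> F2 x)" if "x \<in> X" for x
    using cc1[OF that] cc2[OF that] by (simp add: compact_Times convex_Times)
  have "\<exists>s. continuous_on X s \<and> (\<forall>x\<in>X. s x \<in> F1 x \<times> F2 x \<and> L (s x) = f x)"
    by (rule continuous_selection_of_section[OF cont _ assms(7,8) f(1)])
       (rule cc f(2) int, assumption+)+
  then obtain s where s: "continuous_on X s" "\<forall>x\<in>X. s x \<in> F1 x \<times> F2 x \<and> L (s x) = f x"
    by blast
  show ?thesis
  proof (intro exI conjI)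
    show "continuous_selection X F1 (\<lambda>x. fst (s x))" "continuous_selection X F2 (\<lambda>x. snd (s x))"
      using s continuous_on_fst[OF s(1)] continuous_on_snd[OF s(1)]
      by (simp_all add: continuous_selection_def mem_Times_iff)
    show "\<forall>x\<in>X. f x = L (fst (s x), snd (s x))"
      using s(2) by simp
  qed
qed

end
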